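(* Let $n\ge 31$. Then $\mathbb{E}(P_n(4,4,n-9))<\mathbb{E}(P_n(2,7,n-10))$.
   Context: The energy $\mathbb{E}(G)$ is the sum of absolute values of the adjacency eigenvalues of $G$. $P_n(a_1,\dots,a_k)$ ($k\ge3$, $a_i\ge1$, $\sum a_i=n-1$) is the tree of order $n$ consisting of a central vertex with $k$ internally disjoint pendent paths of lengths $a_1,\dots,a_k$. *)

theory Defs
  imports "Jordan_Normal_Form.Char_Poly"
    "HOL-Computational_Algebra.Fundamental_Theorem_Algebra"
begin

(* A simple graph of order n has vertex set {..<n}; its edges are two-element subsets of {..<n}. *)
type_synonym graph = "nat \<times> nat set set"

definition adjacency_matrix :: "graph \<Rightarrow> complex mat" where
  "adjacency_matrix G =
     mat (fst G) (fst G) (\<lambda>(u, v). if u \<noteq> v \<and> {u, v} \<in> snd G then 1 else 0)"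

(* The matrix is taken over the complex numbers so that proots, which counts roots with
   multiplicity, yields all n eigenvalues without an appeal to the spectral theorem. *)
definition graph_energy :: "graph \<Rightarrow> real" where
  "graph_energy G = (\<Sum>x\<in>#proots (char_poly (adjacency_matrix G)). cmod x)"

(* The j-th vertex on the i-th pendent path, counted from the centre, which is vertex 0 and is
   position 0 of every path. The vertices of the paths are numbered consecutively. *)
definition path_vertex :: "nat list \<Rightarrow> nat \<Rightarrow> nat \<Rightarrow> nat" where
  "path_vertex as i j = (if j = 0 then 0 else sum_list (take i as) + j)"

(* Meant for length as >= 3, all entries of as positive, and sum_list as = n - 1. *)
definition starlike_tree :: "nat \<Rightarrow> nat list \<Rightarrow> graph" where
  "starlike_tree n as =
     (n,
      {{path_vertex as i j, path_vertex as i (Suc j)} | i j. i < length as \<and> j < as ! i})"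

lemma path_vertex_less:
  assumes "i < length as" "j \<le> as ! i"
  shows "path_vertex as i j < Suc (sum_list as)"
proof -
  have "sum_list (take (Suc i) as) + sum_list (drop (Suc i) as) = sum_list as"
    by (metis append_take_drop_id sum_list_append)
  then show ?thesis
    using assms by (auto simp: path_vertex_def take_Suc_conv_app_nth)
qed

lemma path_vertex_eq_iff:
  assumes "i < length as" "0 < j" "j \<le> as ! i" "i' < length as" "j' \<le> as ! i'"
  shows "path_vertex as i j = path_vertex as i' j' \<longleftrightarrow> i = i' \<and> j = j'"
proof -
  have mono: "sum_list (take k as) + as ! k \<le> sum_list (take l as)"
    if "k < l" "k < length as" for k l
  proof -
    have "take l as = take (Suc k) as @ take (l - Suc k) (drop (Suc k) as)"
      using that by (metis Suc_leI le_add_diff_inverse take_add)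
    then show ?thesis
      using that by (simp add: take_Suc_conv_app_nth)
  qed
  show ?thesis
    using mono[of i i'] mono[of i' i] assms
    by (cases i i' rule: linorder_cases) (auto simp: path_vertex_def)
qed

lemma starlike_tree_edge:
  assumes "sum_list as = n - 1" "0 < n" "e \<in> snd (starlike_tree n as)"
  shows "e \<subseteq> {..<n}" "card e = 2"
proof -
  obtain i j where e: "e = {path_vertex as i j, path_vertex as i (Suc j)}"
    and ij: "i < length as" "j < as ! i"
    using assms(3) by (auto simp: starlike_tree_def)
  show "e \<subseteq> {..<n}"
    using path_vertex_less[of i as j] path_vertex_less[of i as "Suc j"] ij assms(1,2)
    by (auto simp: e)
  show "card e = 2"
    using path_vertex_eq_iff[of i as "Suc j" i j] ij by (auto simp: e card_2_iff)
qed

end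

theory Submission
  imports Defs "HOL-Real_Asymp.Real_Asymp"
begin

text \<open>
  Both characteristic polynomials are expressed through those of paths. Evaluated at \<open>i t\<close> they
  become, up to a power of \<open>i\<close>, polynomials in \<open>t\<close> with nonnegative coefficients, and a Cassini-type
  identity gives, for all \<open>t > 0\<close> and \<open>n \<ge> 31\<close>, with \<open>A n = P\<^sub>n(4, 4, n - 9)\<close> and
  \<open>B n = P\<^sub>n(2, 7, n - 10)\<close>, that
  \<open>\<bar>\<phi>(A n) \<phi>(B 31)\<bar> \<le> \<bar>\<phi>(B n) \<phi>(A 31)\<bar>\<close> at \<open>i t\<close>. By Coulson's integral the
  energies then satisfy \<open>E(A n) - E(B n) \<le> E(A 31) - E(B 31)\<close>, and the right-hand side is negative
  (about \<open>-0.00018\<close>) by enclosing the eigenvalues of the two trees of order 31 between rationals.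
\<close>

section \<open>Continuants\<close>

text \<open>
  For \<open>e = 1\<close> this is the characteristic polynomial of the path on \<open>k\<close> vertices. The parameter \<open>e\<close>
  makes it homogeneous: \<open>e = - 1\<close> describes the values on the imaginary axis, and \<open>e = v\<^sup>2\<close> clears
  the denominators of the value at \<open>u / v\<close>.
\<close>

fun continuant :: "'a::comm_ring_1 \<Rightarrow> 'a \<Rightarrow> nat \<Rightarrow> 'a" where
  "continuant e x 0 = 1"
| "continuant e x (Suc 0) = x"
| "continuant e x (Suc (Suc k)) = x * continuant e x (Suc k) - e * continuant e x k"

text \<open>Two initial values determine a solution of the recurrence; \<open>B\<close> acts as the
  value at index -1.\<close>

lemma continuant_eqI:
  assumes "g 0 = A" "g (Suc 0) = x * A - e * B"
    and "\<And>k. g (Suc (Suc k)) = x * g (Suc k) - e * g k"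
  shows "g (Suc k) = A * continuant e x (Suc k) - e * B * continuant e x k"
proof (induction k rule: induct_nat_012)
  case (ge2 k)
  then show ?case
    unfolding assms(3)[of "Suc k"] ge2.IH by (simp add: algebra_simps)
next
  case 1
  show ?case
    using assms(3)[of 0] unfolding assms(1,2) by (simp add: algebra_simps)
qed (use assms(1,2) in simp)

lemma continuant_homogeneous: "continuant (s\<^sup>2 * e) (s * x) k = s ^ k * continuant e x k"
  by (induction e x k rule: continuant.induct) (simp_all add: algebra_simps power2_eq_square)

text \<open>For \<open>e = 1\<close>, the characteristic polynomial of the tree with legs
  \<open>a\<close>, \<open>b\<close>, \<open>c\<close>, expanded along the edge from the centre to
  the third leg: without the edge, paths on \<open>a + b + 1\<close> and \<open>c\<close> vertices
  remain; without its ends, paths on \<open>a\<close>, \<open>b\<close> and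
  \<open>c - 1\<close>.\<close>

definition star_poly :: "'a::comm_ring_1 \<Rightarrow> 'a \<Rightarrow> nat \<Rightarrow> nat \<Rightarrow> nat \<Rightarrow> 'a" where
  "star_poly e x a b c =
     continuant e x (a + b + 1) * continuant e x c
     - e * continuant e x a * continuant e x b * continuant e x (c - 1)"

lemma star_poly_homogeneous:
  assumes "0 < c"
  shows "star_poly (s\<^sup>2 * e) (s * x) a b c = s ^ (a + b + c + 1) * star_poly e x a b c"
  using assms unfolding star_poly_def continuant_homogeneous
  by (cases c) (simp_all add: algebra_simps power_add power2_eq_square)

lemma continuant_of_real:
  "continuant (of_real e) (of_real x) k = (of_real (continuant e x k) :: 'a::{comm_ring_1,real_algebra_1})"
  by (induction e x k rule: continuant.induct) simp_all

lemma star_poly_of_real: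
  "star_poly (of_real e) (of_real x) a b c = (of_real (star_poly e x a b c) :: 'a::{comm_ring_1,real_algebra_1})"
  by (simp add: star_poly_def continuant_of_real)

lemma continuant_of_int: "continuant (of_int e) (of_int x) k = of_int (continuant e x k)"
  by (induction e x k rule: continuant.induct) simp_all

lemma star_poly_of_int: "star_poly (of_int e) (of_int x) a b c = of_int (star_poly e x a b c)"
  by (simp add: star_poly_def continuant_of_int)

section \<open>Inequalities on the imaginary axis\<close>

lemma continuant_neg_nonneg:
  fixes t :: real
  assumes "0 \<le> t"
  shows "0 \<le> continuant (- 1) t k"
  using assms by (induction "- 1 :: real" t k rule: continuant.induct) simp_all

lemma star_poly_neg_nonneg:
  fixes t :: real
  assumes "0 \<le> t"
  shows "0 \<le> star_poly (- 1) t a b c"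
  using continuant_neg_nonneg[OF assms] by (simp add: star_poly_def)

lemma continuant_cassini:
  "continuant e x (Suc (Suc k)) * continuant e x k - (continuant e x (Suc k))\<^sup>2 = - (e ^ Suc k)"
proof (induction k)
  case (Suc k)
  have "continuant e x (Suc (Suc (Suc k))) * continuant e x (Suc k) - (continuant e x (Suc (Suc k)))\<^sup>2 =
      e * (continuant e x (Suc (Suc k)) * continuant e x k - (continuant e x (Suc k))\<^sup>2)"
    by (simp add: algebra_simps power2_eq_square)
  then show ?case
    unfolding Suc.IH by simp
qed (simp add: power2_eq_square)

text \<open>As a function of \<open>k\<close> the expression satisfies the same recurrence, with
  nonnegative coefficients. It is 0 at \<open>k = 0\<close> and, by Cassini's identity for even
  \<open>m\<close>, 1 at \<open>k = 1\<close>.\<close>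

lemma continuant_cross_nonneg:
  fixes t :: real
  assumes "0 \<le> t" "even m"
  shows "0 \<le> continuant (- 1) t (Suc (m + k)) * continuant (- 1) t m
    - continuant (- 1) t (m + k) * continuant (- 1) t (Suc m)"
    (is "0 \<le> ?h k")
proof (induction k rule: induct_nat_012)
  case 1
  then show ?case
    using continuant_cassini[of "- 1" t m] assms(2) by (simp add: power2_eq_square)
next
  case (ge2 k)
  have "?h (Suc (Suc k)) = t * ?h (Suc k) + ?h k"
    by (simp add: algebra_simps)
  then show ?case
    using ge2 assms(1) by (metis add_nonneg_nonneg mult_nonneg_nonneg)
qed simp

text \<open>The right-hand side minus the left-hand side is a product of two determinants, one independent of
  \<open>k\<close> and the other controlled by Cassini's identity.\<close>

lemma star_poly_cross:
  fixes t :: real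
  assumes "0 < t"
  shows "star_poly (- 1) t 4 4 (22 + k) * star_poly (- 1) t 2 7 21
    \<le> star_poly (- 1) t 2 7 (21 + k) * star_poly (- 1) t 4 4 22"
proof -
  define W where "W = continuant (- 1) t"
  have rec: "W (Suc (Suc k)) = t * W (Suc k) + W k" for k
    by (simp add: W_def)
  \<comment> \<open>These are the coefficients, independent of \<open>k\<close>, of the two star
    polynomials in terms of \<open>W (21 + k)\<close> and \<open>W (20 + k)\<close>.\<close>
  define p q r s where "p = t * W 9 + (W 4)\<^sup>2" and "q = W 9" and "r = W 10" and "s = W 2 * W 7"
  have W0: "W 0 = 1" "W 1 = t"
    by (simp_all add: W_def)
  have W2: "W 2 = t^2 + 1"
    using rec[of 0] W0 by (simp add: numeral_2_eq_2 power2_eq_square)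
  have W3: "W 3 = t^3 + 2*t"
    using rec[of 1] W0 W2 by (simp add: eval_nat_numeral algebra_simps)
  have W4: "W 4 = t^4 + 3*t^2 + 1"
    using rec[of 2] W2 W3 by (simp add: eval_nat_numeral algebra_simps)
  have W5: "W 5 = t^5 + 4*t^3 + 3*t"
    using rec[of 3] W3 W4 by (simp add: eval_nat_numeral algebra_simps)
  have W6: "W 6 = t^6 + 5*t^4 + 6*t^2 + 1"
    using rec[of 4] W4 W5 by (simp add: eval_nat_numeral algebra_simps)
  have W7: "W 7 = t^7 + 6*t^5 + 10*t^3 + 4*t"
    using rec[of 5] W5 W6 by (simp add: eval_nat_numeral algebra_simps)
  have W8: "W 8 = t^8 + 7*t^6 + 15*t^4 + 10*t^2 + 1"
    using rec[of 6] W6 W7 by (simp add: eval_nat_numeral algebra_simps)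
  have W9: "W 9 = t^9 + 8*t^7 + 21*t^5 + 20*t^3 + 5*t"
    using rec[of 7] W7 W8 by (simp add: eval_nat_numeral algebra_simps)
  have W10: "W 10 = t^10 + 9*t^8 + 28*t^6 + 35*t^4 + 15*t^2 + 1"
    using rec[of 8] W8 W9 by (simp add: eval_nat_numeral algebra_simps)
  \<comment> \<open>The expansion shows that this determinant has only nonnegative
    coefficients.\<close>
  have "q * r - p * s =
      t^17 + 15*t^15 + 90*t^13 + 278*t^11 + 473*t^9 + 438*t^7 + 202*t^5 + 37*t^3 + t"
    unfolding p_def q_def r_def s_def W2 W4 W7 W9 W10 by (simp add: eval_nat_numeral algebra_simps)
  then have pos: "0 \<le> q * r - p * s"
    using assms by simp
  have s1: "star_poly (- 1) t 4 4 (22 + k) = p * W (Suc (20 + k)) + q * W (20 + k)" for k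
    using rec[of "20 + k"]
    by (simp add: star_poly_def p_def q_def algebra_simps power2_eq_square flip: W_def)
  have s2: "star_poly (- 1) t 2 7 (21 + k) = r * W (Suc (20 + k)) + s * W (20 + k)" for k
    by (simp add: star_poly_def r_def s_def flip: W_def)
  \<comment> \<open>By bilinearity this product is the difference of the two sides; the index 20 is
    even, as the sign of the second factor requires.\<close>
  have "0 \<le> (q * r - p * s) * (W (Suc (20 + k)) * W 20 - W (20 + k) * W (Suc 20))"
    using assms unfolding W_def by (intro mult_nonneg_nonneg pos continuant_cross_nonneg) auto
  then show ?thesis
    unfolding s1 s2 s1[of 0, unfolded add_0_right] s2[of 0, unfolded add_0_right]
    by (simp add: algebra_simps)
qed

section \<open>Characteristic polynomials of starlike trees\<close>

text \<open>Vertex \<open>n\<close> is pendant at \<open>v\<close>: expanding along row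
  \<open>n\<close>, and then along what is left of column \<open>n\<close>, removes both
  vertices.\<close>

lemma det_pendant:
  fixes M :: "nat \<Rightarrow> nat \<Rightarrow> 'a::comm_ring_1"
  assumes v: "v < n" and M: "\<And>j. j < n \<Longrightarrow> j \<noteq> v \<Longrightarrow> M n j = 0 \<and> M j n = 0"
  shows "det (mat (Suc n) (Suc n) (\<lambda>(i, j). M i j)) =
    M n n * det (mat n n (\<lambda>(i, j). M i j)) - M n v * M v n * det (mat_delete (mat n n (\<lambda>(i, j). M i j)) v v)"
proof -
  let ?A = "mat (Suc n) (Suc n) (\<lambda>(i, j). M i j)" and ?B = "mat n n (\<lambda>(i, j). M i j)"
  obtain m where n: "n = Suc m"
    using v by (cases n) auto
  let ?C = "mat_delete ?A n v"
  have delnn: "mat_delete ?A n n = ?B"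
    by (rule eq_matI) (auto simp: mat_delete_def)
  have C: "?C \<in> carrier_mat n n"
    by (rule carrier_matI) auto
  have del_del: "mat_delete ?C v m = mat_delete ?B v v"
    using v by (intro eq_matI) (auto simp: mat_delete_def n)
  \<comment> \<open>The last column of \<open>?C\<close> is what remains of column \<open>n\<close>,
    so it vanishes outside row \<open>v\<close>.\<close>
  have Cm: "?C $$ (i, m) = M i n" if "i < n" for i
    using that v by (auto simp: mat_delete_def n)
  have "det ?C = (\<Sum>i<n. ?C $$ (i, m) * cofactor ?C i m)"
    by (rule laplace_expansion_column[OF C]) (simp add: n)
  also have "\<dots> = (\<Sum>i<n. if i = v then M v n * cofactor ?C v m else 0)"
    by (rule sum.cong) (use M Cm in auto)
  finally have detC: "det ?C = M v n * ((-1) ^ (v + m) * det (mat_delete ?B v v))"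
    using v by (simp add: cofactor_def del_del)
  have "det ?A = (\<Sum>j<Suc n. ?A $$ (n, j) * cofactor ?A n j)"
    by (rule laplace_expansion_row) auto
  also have "\<dots> = (\<Sum>j<n. if j = v then M n v * cofactor ?A n v else 0) + M n n * cofactor ?A n n"
    unfolding sum.lessThan_Suc by (intro arg_cong2[where f = "(+)"] sum.cong) (use M in auto)
  also have "\<dots> = M n v * ((-1) ^ (n + v) * det ?C) + M n n * det ?B"
    using v by (simp add: cofactor_def delnn flip: mult_2 power_mult)
  \<comment> \<open>Since \<open>n = m + 1\<close>, the two cofactor signs multiply to -1.\<close>
  also have "(-1) ^ (n + v) * det ?C = - (M v n * det (mat_delete ?B v v))"
    unfolding detC by (simp add: n power_add mult.assoc mult.left_commute[of _ "M v _"] flip: power_mult_distrib)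
  finally show ?thesis
    by (simp add: algebra_simps)
qed

lemma det_isolated:
  fixes M :: "nat \<Rightarrow> nat \<Rightarrow> 'a::comm_ring_1"
  assumes M: "\<And>j. j < n \<Longrightarrow> M n j = 0"
  shows "det (mat (Suc n) (Suc n) (\<lambda>(i, j). M i j)) = M n n * det (mat n n (\<lambda>(i, j). M i j))"
proof -
  let ?A = "mat (Suc n) (Suc n) (\<lambda>(i, j). M i j)" and ?B = "mat n n (\<lambda>(i, j). M i j)"
  have delnn: "mat_delete ?A n n = ?B"
    by (rule eq_matI) (auto simp: mat_delete_def)
  have "det ?A = (\<Sum>j<Suc n. ?A $$ (n, j) * cofactor ?A n j)"
    by (rule laplace_expansion_row) auto
  also have "\<dots> = (\<Sum>j<n. 0) + M n n * cofactor ?A n n"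
    unfolding sum.lessThan_Suc by (intro arg_cong2[where f = "(+)"] sum.cong) (use M in auto)
  finally show ?thesis
    by (simp add: cofactor_def delnn flip: mult_2 power_mult)
qed

text \<open>
  \<open>tree_det par x s m\<close> belongs to the forest induced on the vertices \<open>s, \<dots>, s + m - 1\<close>, where every
  vertex \<open>v > 0\<close> is joined to its parent \<open>par v\<close>. Deleting the centre 0 amounts to \<open>s = 1\<close>.
\<close>

definition parent_entry :: "(nat \<Rightarrow> nat) \<Rightarrow> 'a::comm_ring_1 \<Rightarrow> nat \<Rightarrow> nat \<Rightarrow> 'a" where
  "parent_entry par x i j =
     (if i = j then x else if (0 < i \<and> par i = j) \<or> (0 < j \<and> par j = i) then - 1 else 0)"

definition tree_det :: "(nat \<Rightarrow> nat) \<Rightarrow> 'a::comm_ring_1 \<Rightarrow> nat \<Rightarrow> nat \<Rightarrow> 'a" where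
  "tree_det par x s m = det (mat m m (\<lambda>(i, j). parent_entry par x (s + i) (s + j)))"

lemma tree_det_0 [simp]: "tree_det par x s 0 = 1"
  by (simp add: tree_det_def)

context
  fixes par :: "nat \<Rightarrow> nat" and x :: "'a::comm_ring_1"
  assumes par: "\<And>v. 0 < v \<Longrightarrow> par v < v"
begin

text \<open>The new vertex is the centre itself, or its parent has been deleted. As parents have
  smaller numbers, it has no neighbour among the earlier vertices.\<close>

lemma tree_det_isolated:
  assumes "s + m = 0 \<or> par (s + m) < s"
  shows "tree_det par x s (Suc m) = x * tree_det par x s m"
proof -
  have "parent_entry par x (s + m) (s + j) = 0" if "j < m" for j
    using that assms par[of "s + j"] unfolding parent_entry_def by auto
  then show ?thesis
    unfolding tree_det_def by (subst det_isolated) (simp_all add: parent_entry_def)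
qed

lemma tree_det_path:
  assumes "par (Suc (s + m)) = s + m"
  shows "tree_det par x s (Suc (Suc m)) = x * tree_det par x s (Suc m) - tree_det par x s m"
proof -
  let ?B = "mat (Suc m) (Suc m) (\<lambda>(i, j). parent_entry par x (s + i) (s + j))"
  have "parent_entry par x (s + Suc m) (s + j) = 0 \<and> parent_entry par x (s + j) (s + Suc m) = 0"
    if "j < Suc m" "j \<noteq> m" for j
    using that assms par[of "s + j"] unfolding parent_entry_def by (cases "s + j = 0") auto
  moreover have "parent_entry par x (s + Suc m) (s + m) = - 1" "parent_entry par x (s + m) (s + Suc m) = - 1"
    "parent_entry par x (s + Suc m) (s + Suc m) = x"
    using assms by (simp_all add: parent_entry_def)
  moreover have "mat_delete ?B m m = mat m m (\<lambda>(i, j). parent_entry par x (s + i) (s + j))"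
    by (rule eq_matI) (auto simp: mat_delete_def)
  ultimately show ?thesis
    unfolding tree_det_def by (subst det_pendant[where v = m]) simp_all
qed

text \<open>The new vertex is pendant at the centre, so deleting its neighbour moves the start from
  0 to 1.\<close>

lemma tree_det_branch:
  assumes "par (Suc m) = 0"
  shows "tree_det par x 0 (Suc (Suc m)) = x * tree_det par x 0 (Suc m) - tree_det par x 1 m"
proof -
  let ?B = "mat (Suc m) (Suc m) (\<lambda>(i, j). parent_entry par x (0 + i) (0 + j))"
  have "parent_entry par x (0 + Suc m) (0 + j) = 0 \<and> parent_entry par x (0 + j) (0 + Suc m) = 0"
    if "j < Suc m" "j \<noteq> 0" for j
    using that assms par[of j] unfolding parent_entry_def by auto
  moreover have "parent_entry par x (0 + Suc m) (0 + 0) = - 1" "parent_entry par x (0 + 0) (0 + Suc m) = - 1"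
    "parent_entry par x (0 + Suc m) (0 + Suc m) = x"
    using assms by (simp_all add: parent_entry_def)
  moreover have "mat_delete ?B 0 0 = mat m m (\<lambda>(i, j). parent_entry par x (1 + i) (1 + j))"
    by (rule eq_matI) (auto simp: mat_delete_def)
  ultimately show ?thesis
    unfolding tree_det_def by (subst det_pendant[where v = 0]) simp_all
qed

end

text \<open>Only the first vertices of the second and third legs are exceptional: the predecessor of
  vertex 1 is already the centre.\<close>

definition star_parent :: "nat \<Rightarrow> nat \<Rightarrow> nat \<Rightarrow> nat" where
  "star_parent a b v = (if v = Suc a \<or> v = Suc (a + b) then 0 else v - 1)"

lemma star_parent_simps:
  "star_parent a b (Suc a) = 0" "star_parent a b (Suc (a + b)) = 0"
  "v \<noteq> a \<Longrightarrow> v \<noteq> a + b \<Longrightarrow> star_parent a b (Suc v) = v"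
  by (simp_all add: star_parent_def)

lemma tree_det_star:
  assumes "0 < a" "0 < b" "0 < c"
  shows "tree_det (star_parent a b) x 0 (a + b + c + 1) = star_poly 1 x a b c"
proof -
  let ?D = "tree_det (star_parent a b) x"
  have par: "star_parent a b v < v" if "0 < v" for v
    using that by (auto simp: star_parent_def)
  note iso = tree_det_isolated[OF par] and path = tree_det_path[OF par] and branch = tree_det_branch[OF par]
  \<comment> \<open>Vertices are added in numerical order. Without the centre the legs are separate
    paths; with it the first two legs form one path.\<close>
  have D1: "?D 1 k = continuant 1 x k" if "k \<le> a" for k
    using that
  proof (induction "1::'a" x k rule: continuant.induct)
    case (3 x k)
    then show ?case
      using tree_det_path[OF par, of 1 k x] by (simp add: star_parent_simps)
  qed (use assms iso[of 1 0] star_parent_simps(3)[of 0] in auto)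
  have D0: "?D 0 k = continuant 1 x k" if "k \<le> Suc a" for k
    using that
  proof (induction "1::'a" x k rule: continuant.induct)
    case (3 x k)
    then show ?case
      using tree_det_path[OF par, of 0 k x] by (simp add: star_parent_simps)
  qed (use iso[of 0 0] in auto)
  have D1b: "?D 1 (a + k) = continuant 1 x a * continuant 1 x k" if "k \<le> b" for k
    using that
  proof (induction k rule: induct_nat_012)
    case (ge2 k)
    then show ?case
      using path[of 1 "a + k" x] by (simp add: star_parent_simps algebra_simps)
  qed (use D1[of a] iso[of 1 a x] in \<open>simp_all add: star_parent_simps\<close>)
  have D0b: "?D 0 (Suc a + k) = continuant 1 x (Suc a + k)" if "k \<le> b" for k
    using that
  proof (induction k rule: induct_nat_012)
    case 1
    then show ?case
      using branch[of a x] D1[of a] D0[of "Suc a"] by (simp add: star_parent_simps)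
  next
    case (ge2 k)
    then show ?case
      using path[of 0 "Suc (a + k)" x] by (simp add: star_parent_simps)
  qed (use D0 in simp)
  obtain c' where c: "c = Suc c'"
    using assms by (cases c) auto
  have "?D 0 (a + b + 1 + Suc c') =
      continuant 1 x (a + b + 1) * continuant 1 x (Suc c')
      - 1 * (continuant 1 x a * continuant 1 x b) * continuant 1 x c'"
  \<comment> \<open>The index runs along the third leg; the value at -1 is that of the first two
    legs without the centre.\<close>
  proof (rule continuant_eqI)
    show "?D 0 (a + b + 1 + 0) = continuant 1 x (a + b + 1)"
      using D0b[of b] by simp
    show "?D 0 (a + b + 1 + Suc 0) = x * continuant 1 x (a + b + 1) - 1 * (continuant 1 x a * continuant 1 x b)"
      using D0b[of b] D1b[of b] branch[of "a + b" x] by (simp add: star_parent_simps)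
    show "?D 0 (a + b + 1 + Suc (Suc k)) = x * ?D 0 (a + b + 1 + Suc k) - 1 * ?D 0 (a + b + 1 + k)" for k
      using path[of 0 "Suc (a + b + k)" x] by (simp add: star_parent_simps)
  qed
  then show ?thesis
    by (simp add: star_poly_def c)
qed

lemma starlike_tree_edges:
  assumes "0 < a" "0 < b" "0 < c"
  shows "snd (starlike_tree n [a, b, c]) = {{star_parent a b v, v} | v. 0 < v \<and> v \<le> a + b + c}"
    (is "?E = ?F")
proof
  have "\<exists>v. {path_vertex [a, b, c] i j, path_vertex [a, b, c] i (Suc j)} = {star_parent a b v, v}
      \<and> 0 < v \<and> v \<le> a + b + c" if "i < 3" "j < [a, b, c] ! i" for i j
  proof (rule exI[of _ "path_vertex [a, b, c] i (Suc j)"])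
    from that(1) consider "i = 0" | "i = 1" | "i = 2"
      by linarith
    then show "{path_vertex [a, b, c] i j, path_vertex [a, b, c] i (Suc j)} =
        {star_parent a b (path_vertex [a, b, c] i (Suc j)), path_vertex [a, b, c] i (Suc j)} \<and>
      0 < path_vertex [a, b, c] i (Suc j) \<and> path_vertex [a, b, c] i (Suc j) \<le> a + b + c"
      using that(2) by cases (auto simp: path_vertex_def star_parent_def numeral_2_eq_2)
  qed
  then show "?E \<subseteq> ?F"
    by (auto simp: starlike_tree_def numeral_3_eq_3)
next
  have "\<exists>i j. {star_parent a b v, v} = {path_vertex [a, b, c] i j, path_vertex [a, b, c] i (Suc j)}
      \<and> i < 3 \<and> j < [a, b, c] ! i" if v: "0 < v" "v \<le> a + b + c" for v
  proof -
    consider "v \<le> a" | "a < v" "v \<le> a + b" | "a + b < v"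
      by linarith
    then show ?thesis
    proof cases
      case 1
      then show ?thesis
        using v by (intro exI[of _ 0] exI[of _ "v - 1"]) (auto simp: path_vertex_def star_parent_def)
    next
      case 2
      then show ?thesis
        using v by (intro exI[of _ 1] exI[of _ "v - a - 1"]) (auto simp: path_vertex_def star_parent_def)
    next
      case 3
      then show ?thesis
        using v assms
        by (intro exI[of _ 2] exI[of _ "v - a - b - 1"])
          (auto simp: path_vertex_def star_parent_def numeral_2_eq_2)
    qed
  qed
  then show "?F \<subseteq> ?E"
    by (auto simp: starlike_tree_def numeral_3_eq_3)
qed

lemma poly_char_poly_starlike_tree:
  assumes abc: "0 < a" "0 < b" "0 < c" and n: "n = a + b + c + 1"
  shows "poly (char_poly (adjacency_matrix (starlike_tree n [a, b, c]))) x = star_poly 1 x a b c"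
proof -
  let ?A = "adjacency_matrix (starlike_tree n [a, b, c])"
  have A: "?A \<in> carrier_mat n n"
    by (simp add: adjacency_matrix_def starlike_tree_def)
  have edge: "{u, v} \<in> snd (starlike_tree n [a, b, c]) \<longleftrightarrow>
      (0 < u \<and> star_parent a b u = v) \<or> (0 < v \<and> star_parent a b v = u)"
    if "u < n" "v < n" for u v
    using that unfolding starlike_tree_edges[OF abc] n by (auto simp: doubleton_eq_iff)
  have "- char_matrix ?A x = mat n n (\<lambda>(i, j). parent_entry (star_parent a b) x (0 + i) (0 + j))"
    by (rule eq_matI) (use A edge in
      \<open>auto simp: char_matrix_def adjacency_matrix_def parent_entry_def starlike_tree_def\<close>)
  then show ?thesis
    unfolding char_poly_matrix[OF A] tree_det_star[OF abc, symmetric] tree_det_def n[symmetric] by simp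
qed

text \<open>The matrix is real and symmetric, so its quadratic form \<open>Q\<close> at an
  eigenvector is real; \<open>Q\<close> is also \<open>k\<close> times the nonzero squared
  norm.\<close>

lemma eigenvalue_adjacency_matrix_real:
  assumes "eigenvalue (adjacency_matrix G) k"
  shows "k \<in> \<real>"
proof -
  define n where "n = fst G"
  define a where "a u v = (if u \<noteq> v \<and> {u, v} \<in> snd G then 1 else 0 :: complex)" for u v
  have A: "adjacency_matrix G = mat n n (\<lambda>(u, v). a u v)"
    by (simp add: adjacency_matrix_def n_def a_def)
  obtain v where v: "v \<in> carrier_vec n" "v \<noteq> 0\<^sub>v n" and eig: "adjacency_matrix G *\<^sub>v v = k \<cdot>\<^sub>v v"
    using assms by (auto simp: eigenvalue_def eigenvector_def A)
  have row: "(\<Sum>j<n. a i j * v $ j) = k * v $ i" if "i < n" for i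
    using arg_cong[OF eig, of "\<lambda>w. w $ i"] that v(1)
    by (simp add: A scalar_prod_def atLeast0LessThan)
  define Q where "Q = (\<Sum>i<n. \<Sum>j<n. cnj (v $ i) * a i j * v $ j)"
  have "cnj Q = (\<Sum>i<n. \<Sum>j<n. cnj (v $ j) * a j i * v $ i)"
    by (auto simp: Q_def a_def insert_commute intro!: sum.cong)
  also have "\<dots> = Q"
    unfolding Q_def by (rule sum.swap)
  finally have "cnj Q = Q" .
  have "Q = (\<Sum>i<n. cnj (v $ i) * (k * v $ i))"
    unfolding Q_def by (rule sum.cong) (simp_all add: mult.assoc row flip: sum_distrib_left)
  also have "\<dots> = k * of_real (\<Sum>i<n. (cmod (v $ i))\<^sup>2)"
    unfolding of_real_sum sum_distrib_left complex_norm_square by (simp add: mult_ac)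
  finally have Q: "Q = k * of_real (\<Sum>i<n. (cmod (v $ i))\<^sup>2)" .
  obtain i where "i < n" "v $ i \<noteq> 0"
    using v by (metis eq_vecI carrier_vecD index_zero_vec)
  then have "(\<Sum>i<n. (cmod (v $ i))\<^sup>2) \<noteq> 0"
    by (subst sum_nonneg_eq_0_iff) auto
  then have "complex_of_real (\<Sum>i<n. (cmod (v $ i))\<^sup>2) \<noteq> 0"
    by (simp only: of_real_eq_0_iff not_False_eq_True)
  moreover have "cnj k * complex_of_real (\<Sum>i<n. (cmod (v $ i))\<^sup>2) = k * complex_of_real (\<Sum>i<n. (cmod (v $ i))\<^sup>2)"
    using \<open>cnj Q = Q\<close> unfolding Q complex_cnj_mult complex_cnj_complex_of_real .
  ultimately have "cnj k = k"
    by simp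
  then show ?thesis
    by (simp add: Reals_cnj_iff)
qed

section \<open>Coulson's comparison of energies\<close>

text \<open>A primitive in \<open>t\<close> of \<open>ln (1 + x\<^sup>2 / t\<^sup>2)\<close>, for \<open>x = 0\<close> as well since \<open>t / 0 = 0\<close>.\<close>

definition coulson :: "real \<Rightarrow> real \<Rightarrow> real" where
  "coulson x t = t * (ln (t\<^sup>2 + x\<^sup>2) - 2 * ln t) + 2 * x * arctan (t / x)"

lemma coulson_deriv:
  assumes "0 < t"
  shows "(coulson x has_real_derivative ln (t\<^sup>2 + x\<^sup>2) - 2 * ln t) (at t)"
proof -
  have pos: "t\<^sup>2 + x\<^sup>2 > 0"
    using assms by (simp add: add_pos_nonneg)
  have "((\<lambda>t. 2 * x * arctan (t / x)) has_real_derivative 2 * x\<^sup>2 / (t\<^sup>2 + x\<^sup>2)) (at t)"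
  proof (cases "x = 0")
    case False
    have "((\<lambda>t. 2 * x * arctan (t / x)) has_real_derivative 2 * x * (inverse (1 + (t / x)\<^sup>2) * (1 / x))) (at t)"
      using False by (auto intro!: derivative_eq_intros)
    moreover have "1 + (t / x)\<^sup>2 = (t\<^sup>2 + x\<^sup>2) / x\<^sup>2"
      using False by (simp add: field_simps)
    ultimately show ?thesis
      using False by (simp add: power2_eq_square)
  qed simp
  moreover have "((\<lambda>t. t * (ln (t\<^sup>2 + x\<^sup>2) - 2 * ln t)) has_real_derivative
      1 * (ln (t\<^sup>2 + x\<^sup>2) - 2 * ln t) + (1 / (t\<^sup>2 + x\<^sup>2) * (2 * t) - 2 * (1 / t)) * t) (at t)"
    using assms pos by (auto intro!: derivative_eq_intros simp: algebra_simps)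
  ultimately have "(coulson x has_real_derivative
      1 * (ln (t\<^sup>2 + x\<^sup>2) - 2 * ln t) + (1 / (t\<^sup>2 + x\<^sup>2) * (2 * t) - 2 * (1 / t)) * t
        + 2 * x\<^sup>2 / (t\<^sup>2 + x\<^sup>2)) (at t)"
    unfolding coulson_def by (rule DERIV_add[rotated])
  \<comment> \<open>The rational terms cancel and only the logarithms remain.\<close>
  moreover have "(1 / (t\<^sup>2 + x\<^sup>2) * (2 * t) - 2 * (1 / t)) * t + 2 * x\<^sup>2 / (t\<^sup>2 + x\<^sup>2) = 0"
    using assms pos by (simp add: divide_simps) (simp add: power2_eq_square algebra_simps)
  ultimately show ?thesis
    by (simp only: add.assoc mult_1 add_0_right)
qed

text \<open>The logarithmic part vanishes in the limit and the arctangent gives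
  \<open>pi * x\<close>. With the limit 0 at the origin, the integral of the derivative over the
  positive axis is thus \<open>pi * x\<close>.\<close>

lemma coulson_at_top:
  assumes "0 \<le> x"
  shows "(coulson x \<longlongrightarrow> pi * x) at_top"
proof (cases "x = 0")
  case False
  with assms have "0 < x" by simp
  then show ?thesis unfolding coulson_def by real_asymp
next
  case True
  then show ?thesis unfolding coulson_def by simp real_asymp
qed

lemma coulson_at_0:
  assumes "0 \<le> x"
  shows "(coulson x \<longlongrightarrow> 0) (at_right 0)"
proof (cases "x = 0")
  case False
  with assms have "0 < x" by simp
  then show ?thesis unfolding coulson_def by real_asymp
next
  case True
  then show ?thesis unfolding coulson_def by simp real_asymp
qed

lemma sum_coulson_deriv:
  assumes "0 < t"
  shows "((\<lambda>t. \<Sum>x\<in>#X. coulson \<bar>x\<bar> t) has_real_derivative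
    ln (\<Prod>x\<in>#X. t\<^sup>2 + x\<^sup>2) - 2 * real (size X) * ln t) (at t)"
proof (induction X)
  case (add x X)
  have "t\<^sup>2 + y\<^sup>2 > 0" for y
    using assms by (simp add: add_pos_nonneg)
  moreover from this have "(\<Prod>x\<in>#X. t\<^sup>2 + x\<^sup>2) > 0"
    by (induction X) auto
  ultimately have "ln (\<Prod>x\<in>#add_mset x X. t\<^sup>2 + x\<^sup>2) = ln (t\<^sup>2 + x\<^sup>2) + ln (\<Prod>x\<in>#X. t\<^sup>2 + x\<^sup>2)"
    unfolding image_mset_add_mset prod_mset.add_mset by (intro ln_mult_pos)
  then show ?case
    using DERIV_add[OF coulson_deriv[OF assms, of "\<bar>x\<bar>"] add.IH] by (simp add: algebra_simps)
qed simp

lemma tendsto_sum_mset: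
  fixes f :: "'a \<Rightarrow> 'b \<Rightarrow> real"
  assumes "\<And>x. x \<in># X \<Longrightarrow> (f x \<longlongrightarrow> l x) F"
  shows "((\<lambda>t. \<Sum>x\<in>#X. f x t) \<longlongrightarrow> (\<Sum>x\<in>#X. l x)) F"
  using assms by (induction X) (auto intro!: tendsto_add)

text \<open>The difference \<open>G\<close> of primitives stands in for the integral. It is
  nondecreasing, since equal sizes cancel the \<open>ln t\<close> terms; it tends to 0 at the origin
  and to \<open>pi\<close> times the difference of the sums at infinity.\<close>

lemma sum_abs_mono_Coulson:
  fixes X Y :: "real multiset"
  assumes size: "size X = size Y"
    and le: "\<And>t. 0 < t \<Longrightarrow> (\<Prod>x\<in>#X. t\<^sup>2 + x\<^sup>2) \<le> (\<Prod>y\<in>#Y. t\<^sup>2 + y\<^sup>2)"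
  shows "(\<Sum>x\<in>#X. \<bar>x\<bar>) \<le> (\<Sum>y\<in>#Y. \<bar>y\<bar>)"
proof -
  define G where "G t = (\<Sum>y\<in>#Y. coulson \<bar>y\<bar> t) - (\<Sum>x\<in>#X. coulson \<bar>x\<bar> t)" for t
  have mono: "G s \<le> G t" if "0 < s" "s \<le> t" for s t
  proof (rule DERIV_nonneg_imp_nondecreasing[OF that(2)])
    fix u assume "s \<le> u" "u \<le> t"
    with that have u: "0 < u" by simp
    have "(\<Prod>x\<in>#X. u\<^sup>2 + x\<^sup>2) > 0"
      using u by (induction X) (auto simp: add_pos_nonneg)
    with le[OF u] have "ln (\<Prod>x\<in>#X. u\<^sup>2 + x\<^sup>2) \<le> ln (\<Prod>y\<in>#Y. u\<^sup>2 + y\<^sup>2)"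
      by (intro ln_mono) auto
    moreover have "DERIV G u :> ln (\<Prod>y\<in>#Y. u\<^sup>2 + y\<^sup>2) - ln (\<Prod>x\<in>#X. u\<^sup>2 + x\<^sup>2)"
      using DERIV_diff[OF sum_coulson_deriv[OF u, of Y] sum_coulson_deriv[OF u, of X]]
      by (simp add: G_def[abs_def] size)
    ultimately show "\<exists>y. DERIV G u :> y \<and> y \<ge> 0"
      by (intro exI conjI) auto
  qed
  have lim0: "(G \<longlongrightarrow> (\<Sum>y\<in>#Y. 0) - (\<Sum>x\<in>#X. 0)) (at_right 0)"
    unfolding G_def by (intro tendsto_diff tendsto_sum_mset coulson_at_0) auto
  have nonneg: "0 \<le> G t" if "0 < t" for t
  proof (rule tendsto_upperbound)
    show "(G \<longlongrightarrow> 0) (at_right 0)"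
      using lim0 by simp
    show "\<forall>\<^sub>F s in at_right 0. G s \<le> G t"
      using eventually_at_right_less[of 0] eventually_at_right_real[OF that]
      by eventually_elim (auto intro: mono)
  qed simp
  have "(G \<longlongrightarrow> (\<Sum>y\<in>#Y. pi * \<bar>y\<bar>) - (\<Sum>x\<in>#X. pi * \<bar>x\<bar>)) at_top"
    unfolding G_def by (intro tendsto_diff tendsto_sum_mset coulson_at_top) auto
  then have "0 \<le> (\<Sum>y\<in>#Y. pi * \<bar>y\<bar>) - (\<Sum>x\<in>#X. pi * \<bar>x\<bar>)"
    by (rule tendsto_lowerbound)
      (auto intro: eventually_mono[OF eventually_gt_at_top[of 0]] nonneg)
  then have "pi * (\<Sum>x\<in>#X. \<bar>x\<bar>) \<le> pi * (\<Sum>y\<in>#Y. \<bar>y\<bar>)"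
    by (simp add: sum_mset_distrib_left multiset.map_comp comp_def)
  then show ?thesis
    by (rule mult_left_le_imp_le) (rule pi_gt_zero)
qed

section \<open>Energies and characteristic polynomials through the real spectrum\<close>

definition real_spectrum :: "graph \<Rightarrow> real multiset" where
  "real_spectrum G = image_mset Re (proots (char_poly (adjacency_matrix G)))"

lemma adjacency_matrix_carrier: "adjacency_matrix G \<in> carrier_mat (fst G) (fst G)"
  by (simp add: adjacency_matrix_def)

lemma proots_char_poly_real:
  assumes "x \<in># proots (char_poly (adjacency_matrix G))"
  shows "x \<in> \<real>"
proof -
  have "char_poly (adjacency_matrix G) \<noteq> 0"
    using degree_monic_char_poly[OF adjacency_matrix_carrier[of G]] by auto
  then show ?thesis
    using assms eigenvalue_adjacency_matrix_real[of G x]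
    by (simp add: eigenvalue_root_char_poly[OF adjacency_matrix_carrier])
qed

lemma size_real_spectrum: "size (real_spectrum G) = fst G"
  using degree_monic_char_poly[OF adjacency_matrix_carrier[of G]]
  by (simp add: real_spectrum_def size_proots_complex)

lemma graph_energy_real_spectrum: "graph_energy G = (\<Sum>x\<in>#real_spectrum G. \<bar>x\<bar>)"
  unfolding graph_energy_def real_spectrum_def multiset.map_comp
  by (intro arg_cong[where f = sum_mset] image_mset_cong)
    (auto dest!: proots_char_poly_real elim!: Reals_cases)

text \<open>For a real eigenvalue \<open>x\<close>, the squared modulus of
  \<open>\<i> * t - x\<close> is \<open>t^2 + x^2\<close>.\<close>

lemma prod_real_spectrum:
  "(\<Prod>x\<in>#real_spectrum G. t\<^sup>2 + x\<^sup>2) = (cmod (poly (char_poly (adjacency_matrix G)) (\<i> * of_real t)))\<^sup>2"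
proof -
  let ?p = "char_poly (adjacency_matrix G)"
  have "?p = (\<Prod>x\<in>#proots ?p. [:- x, 1:])"
    using complex_poly_decompose_multiset[of ?p]
      degree_monic_char_poly[OF adjacency_matrix_carrier[of G]] by simp
  then have "poly ?p (\<i> * of_real t) = (\<Prod>x\<in>#proots ?p. \<i> * of_real t - x)"
    by (metis (no_types, lifting) image_mset_cong poly_prod_mset poly_pCons poly_0
        mult_zero_right add_0_right mult_1_right uminus_add_conv_diff)
  moreover have "(cmod (\<Prod>x\<in>#A. \<i> * of_real t - x))\<^sup>2 = (\<Prod>x\<in>#A. (cmod (\<i> * of_real t - x))\<^sup>2)" for A
    by (induction A) (simp_all add: norm_mult power_mult_distrib)
  moreover have "(\<Prod>x\<in>#proots ?p. (cmod (\<i> * of_real t - x))\<^sup>2) = (\<Prod>x\<in>#proots ?p. t\<^sup>2 + (Re x)\<^sup>2)"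
    by (intro arg_cong[where f = prod_mset] image_mset_cong)
      (auto dest!: proots_char_poly_real elim!: Reals_cases simp: cmod_power2)
  ultimately show ?thesis
    by (simp add: real_spectrum_def multiset.map_comp comp_def)
qed

lemma prod_real_spectrum_starlike_tree:
  assumes abc: "0 < a" "0 < b" "0 < c" and n: "n = a + b + c + 1"
  shows "(\<Prod>x\<in>#real_spectrum (starlike_tree n [a, b, c]). t\<^sup>2 + x\<^sup>2) = (star_poly (- 1) t a b c)\<^sup>2"
proof -
  \<comment> \<open>Scaling by \<open>\<i>\<close> turns \<open>e = - 1\<close> into
    \<open>e = 1\<close>; the factor \<open>\<i> ^ n\<close> has modulus 1.\<close>
  have "star_poly 1 (\<i> * of_real t) a b c = \<i> ^ n * star_poly (- 1) (of_real t) a b c"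
    using star_poly_homogeneous[OF abc(3), of \<i> "- 1" "of_real t" a b] by (simp add: n)
  also have "star_poly (- 1) (of_real t) a b c = complex_of_real (star_poly (- 1) t a b c)"
    using star_poly_of_real[of "- 1" t a b c] by simp
  finally show ?thesis
    by (simp add: prod_real_spectrum poly_char_poly_starlike_tree[OF abc n] norm_mult norm_power)
qed

text \<open>Joining spectra multiplies the products, so an inequality between quotients can be
  stated for two pairs of graphs.\<close>

lemma energy_sum_mono:
  assumes "fst G1 + fst G2 = fst H1 + fst H2"
    and "\<And>t. 0 < t \<Longrightarrow> (\<Prod>x\<in>#real_spectrum G1 + real_spectrum G2. t\<^sup>2 + x\<^sup>2)
      \<le> (\<Prod>x\<in>#real_spectrum H1 + real_spectrum H2. t\<^sup>2 + x\<^sup>2)"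
  shows "graph_energy G1 + graph_energy G2 \<le> graph_energy H1 + graph_energy H2"
  using sum_abs_mono_Coulson[of "real_spectrum G1 + real_spectrum G2" "real_spectrum H1 + real_spectrum H2"] assms
  by (simp add: graph_energy_real_spectrum size_real_spectrum)

section \<open>Enclosing the energy of a starlike tree\<close>

lemma continuous_on_continuant: "continuous_on A (\<lambda>x. continuant (e::real) x k)"
proof (induction k rule: induct_nat_012)
  case (ge2 k)
  show ?case
    unfolding continuant.simps by (intro continuous_intros ge2.IH)
qed simp_all

lemma continuous_on_star_poly: "continuous_on A (\<lambda>x. star_poly (e::real) x a b c)"
  unfolding star_poly_def by (intro continuous_intros continuous_on_continuant)

lemma sign_change_imp_root:
  fixes f :: "real \<Rightarrow> real"
  assumes "continuous_on {u..v} f" "u < v" "f u * f v < 0"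
  shows "\<exists>x. u < x \<and> x < v \<and> f x = 0"
proof -
  have "\<exists>x\<ge>u. x \<le> v \<and> f x = 0"
    using assms IVT'[of f u 0 v] IVT2'[of f v 0 u] by (auto simp: mult_less_0_iff)
  then show ?thesis
    using assms(3) by (metis less_eq_real_def mult_eq_0_iff order_less_irrefl)
qed

text \<open>At odd order the polynomial is odd. The \<open>m\<close> positive roots found by sign
  changes, their negatives and 0 are \<open>2 * m + 1 = n\<close> distinct roots, hence the whole
  spectrum.\<close>

lemma starlike_tree_energy_eq_sum_roots:
  fixes z :: "nat \<Rightarrow> real"
  assumes abc: "0 < a" "0 < b" "0 < c" and n: "n = a + b + c + 1" "n = 2 * m + 1"
    and z: "0 < z 0" "\<And>j. j < m \<Longrightarrow> z j < z (Suc j)"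
    and signs: "\<And>j. j < m \<Longrightarrow> star_poly 1 (z j) a b c * star_poly 1 (z (Suc j)) a b c < 0"
  obtains r where "\<And>j. j < m \<Longrightarrow> z j < r j \<and> r j < z (Suc j)"
    and "graph_energy (starlike_tree n [a, b, c]) = 2 * (\<Sum>j<m. r j)"
proof -
  let ?P = "\<lambda>x::real. star_poly 1 x a b c"
  let ?p = "char_poly (adjacency_matrix (starlike_tree n [a, b, c]))"
  have "\<exists>x. z j < x \<and> x < z (Suc j) \<and> ?P x = 0" if "j < m" for j
    using sign_change_imp_root[OF continuous_on_star_poly z(2)[OF that] signs[OF that]] .
  then obtain r where r: "\<And>j. j < m \<Longrightarrow> z j < r j" "\<And>j. j < m \<Longrightarrow> r j < z (Suc j)"
    "\<And>j. j < m \<Longrightarrow> ?P (r j) = 0"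
    by metis
  have z_mono: "z i \<le> z j" if "i \<le> j" "j \<le> m" for i j
    using that
  proof (induction rule: dec_induct)
    case (step j)
    then show ?case
      using z(2)[of j] by simp
  qed simp
  have r_less: "r i < r j" if "i < j" "j < m" for i j
    using r(2)[of i] z_mono[of "Suc i" j] r(1)[of j] that by simp
  have r_pos: "0 < r j" if "j < m" for j
    using z_mono[of 0 j] z(1) r(1)[OF that] that by simp
  have inj: "inj_on r {..<m}"
    by (rule inj_onI) (metis lessThan_iff less_irrefl linorder_neqE_nat r_less)
  define R where "R = r ` {..<m}"
  define S where "S = insert 0 (R \<union> uminus ` R)"
  have R: "finite R" "\<And>x. x \<in> R \<Longrightarrow> 0 < x" "\<And>x. x \<in> R \<Longrightarrow> ?P x = 0"
    using r_pos r(3) by (auto simp: R_def)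
  have disj: "R \<inter> uminus ` R = {}" "0 \<notin> R \<union> uminus ` R"
  proof -
    have "- y \<notin> R" if "y \<in> R" for y
      using R(2)[of y] R(2)[of "- y"] that by auto
    then show "R \<inter> uminus ` R = {}" "0 \<notin> R \<union> uminus ` R"
      using R(2)[of 0] by force+
  qed
  have "card R = m"
    using inj by (simp add: R_def card_image)
  then have card_S: "card S = n"
    using disj R(1) by (simp add: S_def card_Un_disjoint card_image n(2))
  have odd: "?P (- x) = - ?P x" for x
    using star_poly_homogeneous[OF abc(3), of "- 1" 1 x a b] unfolding n(1)[symmetric] n(2) by simp
  have S_root: "poly ?p (of_real x) = 0" if "x \<in> S" for x
    using that R(3) odd odd[of 0] star_poly_of_real[of 1 x a b c, where 'a = complex]
    by (auto simp: poly_char_poly_starlike_tree[OF abc n(1)] S_def)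
  have p: "degree ?p = n" "?p \<noteq> 0"
    using degree_monic_char_poly[OF adjacency_matrix_carrier[of "starlike_tree n [a, b, c]"]]
    by (auto simp: starlike_tree_def)
  have "mset_set (complex_of_real ` S) \<subseteq># proots ?p"
    using S_root p(2)
    by (intro mset_subset_eqI) (auto simp: count_mset_set' Suc_le_eq order_gt_0_iff)
  moreover have "size (mset_set (complex_of_real ` S)) = size (proots ?p)"
    by (simp add: size_proots_complex p(1) card_S card_image inj_on_def)
  ultimately have roots: "proots ?p = mset_set (complex_of_real ` S)"
    by (metis less_irrefl mset_subset_size subset_mset.less_le)
  have "graph_energy (starlike_tree n [a, b, c]) = (\<Sum>x\<in>complex_of_real ` S. cmod x)"
    by (simp add: graph_energy_def roots sum_unfold_sum_mset)
  also have "\<dots> = (\<Sum>x\<in>S. \<bar>x\<bar>)"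
    by (subst sum.reindex) (auto simp: inj_on_def)
  also have "\<dots> = (\<Sum>x\<in>R. \<bar>x\<bar>) + (\<Sum>x\<in>uminus ` R. \<bar>x\<bar>)"
    using disj R(1) by (simp add: S_def sum.union_disjoint)
  also have "(\<Sum>x\<in>uminus ` R. \<bar>x\<bar>) = (\<Sum>x\<in>R. \<bar>x\<bar>)"
    by (subst sum.reindex) auto
  also have "(\<Sum>x\<in>R. \<bar>x\<bar>) = (\<Sum>j<m. \<bar>r j\<bar>)"
    unfolding R_def by (subst sum.reindex[OF inj]) simp
  also have "\<dots> = (\<Sum>j<m. r j)"
    using r_pos by (intro sum.cong) (auto simp: less_imp_le)
  finally show ?thesis
    using r by (intro that[of r]) simp_all
qed

section \<open>Sign checks in integer arithmetic\<close>

text \<open>Computes two consecutive values at once: the recursion defining \<open>continuant\<close> branches exponentially.\<close>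

definition continuant_pair :: "int \<Rightarrow> int \<Rightarrow> nat \<Rightarrow> int \<times> int" where
  "continuant_pair e x k = ((\<lambda>(p, q). (q, x * q - e * p)) ^^ k) (1, x)"

lemma continuant_pair_eq: "continuant_pair e x k = (continuant e x k, continuant e x (Suc k))"
  by (induction k) (simp_all add: continuant_pair_def)

definition int_star_poly :: "nat \<Rightarrow> nat \<Rightarrow> nat \<Rightarrow> int \<times> int \<Rightarrow> int" where
  "int_star_poly a b c = (\<lambda>(u, v). star_poly (v\<^sup>2) u a b c)"

lemma int_star_poly_code [code]:
  "int_star_poly a b c (u, v) =
     fst (continuant_pair (v * v) u (a + b + 1)) * fst (continuant_pair (v * v) u c)
     - v * v * fst (continuant_pair (v * v) u a) * fst (continuant_pair (v * v) u b)
       * fst (continuant_pair (v * v) u (c - 1))"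
  by (simp add: int_star_poly_def star_poly_def continuant_pair_eq power2_eq_square)

definition ratio :: "int \<times> int \<Rightarrow> real" where
  "ratio = (\<lambda>(u, v). of_int u / of_int v)"

text \<open>Homogeneity with the denominator as scaling factor: a positive factor leaves the sign at
  a rational point readable from an integer.\<close>

lemma int_star_poly_ratio:
  assumes "0 < c" "0 < snd g"
  shows "of_int (int_star_poly a b c g) = of_int (snd g) ^ (a + b + c + 1) * star_poly 1 (ratio g) a b c"
  using star_poly_homogeneous[OF assms(1), of "of_int (snd g)" "1::real" "ratio g" a b]
    star_poly_of_int[of "(snd g)\<^sup>2" "fst g" a b c, where 'a = real] assms(2)
  by (simp add: int_star_poly_def ratio_def split_beta)

text \<open>Each gap between neighbouring grid points holds one positive eigenvalue. Dropping the
  last point leaves the left ends, dropping the first the right ends.\<close>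

lemma starlike_tree_energy_bounds:
  assumes abc: "0 < a" "0 < b" "0 < c" and n: "n = a + b + c + 1" "n + 1 = 2 * length gs"
    and pos: "\<forall>g\<in>set gs. 0 < snd g" "0 < fst (hd gs)"
    and mono: "successively (\<lambda>g h. ratio g < ratio h) gs"
    and signs: "successively (\<lambda>p q. p * q < 0) (map (int_star_poly a b c) gs)"
  shows "2 * sum_list (map ratio (butlast gs)) \<le> graph_energy (starlike_tree n [a, b, c])"
    and "graph_energy (starlike_tree n [a, b, c]) \<le> 2 * sum_list (map ratio (tl gs))"
proof -
  define m where "m = length gs - 1"
  have len: "length gs = Suc m"
    using n by (cases gs) (simp_all add: m_def)
  define z where "z j = ratio (gs ! j)" for j
  have "0 < z 0"
    using pos len by (cases gs) (auto simp: z_def ratio_def)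
  moreover have "z j < z (Suc j)" if "j < m" for j
    using mono that len by (simp add: successively_conv_nth z_def)
  moreover have "star_poly 1 (z j) a b c * star_poly 1 (z (Suc j)) a b c < 0" if "j < m" for j
  proof -
    let ?v = "\<lambda>j. (of_int (snd (gs ! j)) :: real) ^ (a + b + c + 1)"
    have v: "0 < snd (gs ! i)" if "i \<le> m" for i
      using pos(1) that len by (auto simp: less_Suc_eq_le)
    have "int_star_poly a b c (gs ! j) * int_star_poly a b c (gs ! Suc j) < 0"
      using signs that len by (simp add: successively_conv_nth)
    then have "of_int (int_star_poly a b c (gs ! j)) * of_int (int_star_poly a b c (gs ! Suc j)) < (0::real)"
      by (simp only: of_int_less_0_iff flip: of_int_mult)
    also have "of_int (int_star_poly a b c (gs ! j)) * of_int (int_star_poly a b c (gs ! Suc j)) =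
        (?v j * ?v (Suc j)) * (star_poly 1 (z j) a b c * star_poly 1 (z (Suc j)) a b c)"
      using v[of j] v[of "Suc j"] that by (simp add: int_star_poly_ratio abc z_def mult_ac del: power_Suc)
    finally show ?thesis
      using v[of j] v[of "Suc j"] that
      by (subst (asm) mult_less_0_iff) (auto simp: mult_less_0_iff zero_less_mult_iff not_less[symmetric])
  qed
  ultimately obtain r where r: "\<And>j. j < m \<Longrightarrow> z j < r j \<and> r j < z (Suc j)"
    and E: "graph_energy (starlike_tree n [a, b, c]) = 2 * (\<Sum>j<m. r j)"
    using starlike_tree_energy_eq_sum_roots[OF abc n(1), of m z] n(2) len by auto
  have "sum_list (map ratio (butlast gs)) = (\<Sum>j<m. z j)"
    by (simp add: sum_list_sum_nth len z_def nth_butlast atLeast0LessThan)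
  also have "\<dots> \<le> (\<Sum>j<m. r j)"
    using r by (intro sum_mono less_imp_le) simp
  finally show "2 * sum_list (map ratio (butlast gs)) \<le> graph_energy (starlike_tree n [a, b, c])"
    by (simp add: E)
  have "(\<Sum>j<m. r j) \<le> (\<Sum>j<m. z (Suc j))"
    using r by (intro sum_mono less_imp_le) simp
  also have "\<dots> = sum_list (map ratio (tl gs))"
    by (simp add: sum_list_sum_nth len z_def nth_tl atLeast0LessThan)
  finally show "graph_energy (starlike_tree n [a, b, c]) \<le> 2 * sum_list (map ratio (tl gs))"
    by (simp add: E)
qed

text \<open>
  Fractions \<open>u / v\<close>, stored as pairs \<open>(u, v)\<close>, that separate the positive eigenvalues: apart from
  the first one they lie just above the 15 positive eigenvalues of \<open>P\<^bsub>31\<^esub>(4, 4, 22)\<close>. In the grid for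
  \<open>P\<^bsub>31\<^esub>(2, 7, 21)\<close> all but the last lie just below. The errors add up to less than half the difference
  of the energies, with denominators kept small.
\<close>

definition grid_4_4_22 :: "(int \<times> int) list" where
  "grid_4_4_22 = [(1, 10), (43, 211), (225, 523), (233, 377), (355, 534), (473, 530), (425, 386),
     (539, 423), (577, 408), (3167, 2031), (610, 377), (737, 433), (821, 450), (4583, 2389),
     (4652, 2351), (854, 405)]"

definition grid_2_7_21 :: "(int \<times> int) list" where
  "grid_2_7_21 = [(41, 204), (256, 661), (125, 208), (265, 329), (876, 1007), (2161, 2015),
     (220, 173), (834, 613), (914, 611), (916, 553), (350, 197), (677, 370), (1516, 793),
     (419, 212), (1791, 856), (3, 1)]"

lemma grid_signs_4_4_22: "successively (\<lambda>p q. p * q < 0) (map (int_star_poly 4 4 22) grid_4_4_22)"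
  by code_simp

lemma grid_signs_2_7_21: "successively (\<lambda>p q. p * q < 0) (map (int_star_poly 2 7 21) grid_2_7_21)"
  by code_simp

lemma energy_31_less:
  "graph_energy (starlike_tree 31 [4, 4, 22]) < graph_energy (starlike_tree 31 [2, 7, 21])"
proof -
  have "graph_energy (starlike_tree 31 [4, 4, 22]) \<le> 2 * sum_list (map ratio (tl grid_4_4_22))"
    by (rule starlike_tree_energy_bounds(2)[OF _ _ _ _ _ _ _ _ grid_signs_4_4_22])
      (simp_all add: grid_4_4_22_def ratio_def)
  \<comment> \<open>Each bound uses the ends close to the eigenvalues; what remains is an inequality
    of explicit rationals.\<close>
  also have "\<dots> < 2 * sum_list (map ratio (butlast grid_2_7_21))"
    by (simp add: grid_4_4_22_def grid_2_7_21_def ratio_def)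
  also have "\<dots> \<le> graph_energy (starlike_tree 31 [2, 7, 21])"
    by (rule starlike_tree_energy_bounds(1)[OF _ _ _ _ _ _ _ _ grid_signs_2_7_21])
      (simp_all add: grid_2_7_21_def ratio_def)
  finally show ?thesis .
qed

section \<open>From order 31 to all larger orders\<close>

theorem theorem5p5:
  fixes n :: nat
  assumes "n \<ge> 31"
  shows "graph_energy (starlike_tree n [4, 4, n - 9])
           < graph_energy (starlike_tree n [2, 7, n - 10])"
proof -
  obtain k where n: "n = 31 + k"
    using assms by (auto simp: le_iff_add)
  let ?A = "\<lambda>k. starlike_tree (31 + k) [4, 4, 22 + k]" and ?B = "\<lambda>k. starlike_tree (31 + k) [2, 7, 21 + k]"
  have spectrum: "(\<Prod>x\<in>#real_spectrum (?A k). t\<^sup>2 + x\<^sup>2) = (star_poly (- 1) t 4 4 (22 + k))\<^sup>2"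
    "(\<Prod>x\<in>#real_spectrum (?B k). t\<^sup>2 + x\<^sup>2) = (star_poly (- 1) t 2 7 (21 + k))\<^sup>2" for k t
    by (rule prod_real_spectrum_starlike_tree; simp)+
  have "graph_energy (?A k) + graph_energy (?B 0) \<le> graph_energy (?B k) + graph_energy (?A 0)"
  proof (rule energy_sum_mono)
    fix t :: real
    assume t: "0 < t"
    have "(star_poly (- 1) t 4 4 (22 + k) * star_poly (- 1) t 2 7 (21 + 0))\<^sup>2
        \<le> (star_poly (- 1) t 2 7 (21 + k) * star_poly (- 1) t 4 4 (22 + 0))\<^sup>2"
      using star_poly_cross[OF t, of k] t by (intro power_mono) (simp_all add: star_poly_neg_nonneg)
    then show "(\<Prod>x\<in>#real_spectrum (?A k) + real_spectrum (?B 0). t\<^sup>2 + x\<^sup>2)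
        \<le> (\<Prod>x\<in>#real_spectrum (?B k) + real_spectrum (?A 0). t\<^sup>2 + x\<^sup>2)"
      unfolding image_mset_union prod_mset.union spectrum power_mult_distrib .
  qed (simp add: starlike_tree_def)
  \<comment> \<open>Strictness comes from the case of order 31.\<close>
  then show ?thesis
    using energy_31_less by (simp add: n)
qed

end
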